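(* Let $C$ be a cycle of length 3 in the complete graph $K_4$. Then no 2-factor of $\mathrm{Blowup}(K_4,C)$ can be part of a cycle double cover of $\mathrm{Blowup}(K_4,C)$; that is, there is no cycle double cover of $\mathrm{Blowup}(K_4,C)$ which contains all the component cycles of some 2-factor of $\mathrm{Blowup}(K_4,C)$.
   Context: A cycle double cover (CDC) of a graph is a multiset of cycles such that every edge is covered by exactly two cycles (counted with multiplicity). A cycle is a connected 2-regular subgraph; a 2-factor is a spanning 2-regular subgraph. A multipole consists of vertices, edges, and semiedges; a semiedge is an edge incident to exactly one vertex, with its other end free. Connecting a semiedge to a vertex $v$ means attaching its free end to $v$, making it an ordinary edge. The 4-pole $B$: take the Petersen graph and remove two adjacent vertices $x,y$, keeping the four edges from $\{x,y\}$ to the remaining 8 vertices as semiedges. The two semiedges coming from edges formerly incident to $x$ are called $a_1,a_2$, and the two coming from edges formerly incident to $y$ are called $b_1,b_2$. $\mathrm{Blowup}(G,D)$, for a 2-edge-connected cubic graph $G$ and a 2-regular subgraph $D$ of $G$: for every cycle $(v_1,\dots,v_k)$ of $D$ (indices modulo $k$), remove all edges $v_iv_{i+1}$ and add $k$ copies $B_1,\dots,B_k$ of $B$, with semiedges $a_1^i,a_2^i,b_1^i,b_2^i$ of $B_i$. For each $i\in\{1,\dots,k\}$ add two new vertices $u_i,w_i$ and the edges $v_iu_i$, $v_iw_i$, and connect $u_i$ with $b_1^i$, $w_i$ with $b_2^i$, $a_1^i$ with $u_{i+1}$, and $a_2^i$ with $w_{i+1}$. (So $\mathrm{Blowup}(K_4,C)$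 has 34 vertices.) *)

theory Defs
  imports Main "HOL-Library.Multiset"
begin

text \<open>Finite simple undirected graphs; an edge is the two-element set of its ends.\<close>

record 'a ugraph =
  gverts :: "'a set"
  gedges :: "'a set set"

definition wf_ugraph :: "'a ugraph \<Rightarrow> bool" where
  "wf_ugraph G \<longleftrightarrow> finite (gverts G) \<and> (\<forall>e \<in> gedges G. e \<subseteq> gverts G \<and> card e = 2)"

definition subgraph :: "'a ugraph \<Rightarrow> 'a ugraph \<Rightarrow> bool" where
  "subgraph H G \<longleftrightarrow> wf_ugraph H \<and> gverts H \<subseteq> gverts G \<and> gedges H \<subseteq> gedges G"

definition degree :: "'a ugraph \<Rightarrow> 'a \<Rightarrow> nat" where
  "degree G v = card {e \<in> gedges G. v \<in> e}"

definition regular :: "nat \<Rightarrow> 'a ugraph \<Rightarrow> bool" where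
  "regular k G \<longleftrightarrow> (\<forall>v \<in> gverts G. degree G v = k)"

definition connected_graph :: "'a ugraph \<Rightarrow> bool" where
  "connected_graph G \<longleftrightarrow> gverts G \<noteq> {} \<and>
     (\<forall>u \<in> gverts G. \<forall>v \<in> gverts G. (u, v) \<in> {(x, y). {x, y} \<in> gedges G}\<^sup>*)"

definition component :: "'a ugraph \<Rightarrow> 'a ugraph \<Rightarrow> bool" where
  "component H G \<longleftrightarrow> subgraph H G \<and> connected_graph H \<and>
     (\<forall>H'. subgraph H' G \<and> connected_graph H' \<and> subgraph H H' \<longrightarrow> H' = H)"

definition cycle_in :: "'a ugraph \<Rightarrow> 'a ugraph \<Rightarrow> bool" where
  "cycle_in H G \<longleftrightarrow> subgraph H G \<and> connected_graph H \<and> regular 2 H"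

definition cycle_length :: "'a ugraph \<Rightarrow> nat" where
  "cycle_length H = card (gedges H)"

definition two_factor :: "'a ugraph \<Rightarrow> 'a ugraph \<Rightarrow> bool" where
  "two_factor F G \<longleftrightarrow> subgraph F G \<and> gverts F = gverts G \<and> regular 2 F"

definition cycle_double_cover :: "'a ugraph multiset \<Rightarrow> 'a ugraph \<Rightarrow> bool" where
  "cycle_double_cover M G \<longleftrightarrow> (\<forall>H \<in># M. cycle_in H G) \<and>
     (\<forall>e \<in> gedges G. size {#H \<in># M. e \<in> gedges H#} = 2)"

definition complete_graph :: "'a set \<Rightarrow> 'a ugraph" where
  "complete_graph V = \<lparr>gverts = V, gedges = {e. e \<subseteq> V \<and> card e = 2}\<rparr>"

definition remove_verts :: "'a ugraph \<Rightarrow> 'a set \<Rightarrow> 'a ugraph" where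
  "remove_verts G S = \<lparr>gverts = gverts G - S, gedges = {e \<in> gedges G. e \<inter> S = {}}\<rparr>"

text \<open>The outer 5-cycle is on 0..4, the inner pentagram on 5..9, and the spokes join
  \<open>i\<close> to \<open>i + 5\<close>.\<close>

definition petersen :: "nat ugraph" where
  "petersen = \<lparr>gverts = {..<10},
     gedges = (\<Union>i \<in> {..<5}. {{i, (i + 1) mod 5}, {i, i + 5}, {i + 5, (i + 2) mod 5 + 5}})\<rparr>"

text \<open>The 4-pole \<open>B\<close> is obtained with \<open>x = 0\<close> and \<open>y = 1\<close>. A semiedge is recorded by the
  vertex of \<open>B\<close> it is incident to; connecting it to a vertex \<open>v\<close> yields the edge from that
  vertex to \<open>v\<close>. The automorphisms of the Petersen graph make all choices of the adjacent pair
  and of the numbering of the semiedges equivalent.\<close>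

definition B_graph :: "nat ugraph" where
  "B_graph = remove_verts petersen {0, 1}"

definition B_a1 :: nat where "B_a1 = 4"
definition B_a2 :: nat where "B_a2 = 5"
definition B_b1 :: nat where "B_b1 = 2"
definition B_b2 :: nat where "B_b2 = 6"

lemma petersen_edges:
  "gedges petersen = {{4,0},{4,9},{9,6},{3,4},{3,8},{8,5},{2,3},{2,7},{7,9},
     {1,2},{1,6},{6,8},{0,1},{0,5},{5,7}}"
proof -
  have "{..<5::nat} = {0,1,2,3,4}" by auto
  then show ?thesis by (simp add: petersen_def numeral_2_eq_2)
qed

lemma petersen_neighbours:
  "{0, v} \<in> gedges petersen \<longleftrightarrow> v = 1 \<or> v = 4 \<or> v = 5"
  "{1, v} \<in> gedges petersen \<longleftrightarrow> v = 0 \<or> v = 2 \<or> v = 6"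
  by (simp_all add: petersen_edges doubleton_eq_iff disj_ac)

lemma B_semiedges_a: "{v \<in> gverts B_graph. {0, v} \<in> gedges petersen} = {B_a1, B_a2}"
  unfolding petersen_neighbours
  by (auto simp: B_graph_def remove_verts_def petersen_def B_a1_def B_a2_def)

lemma B_semiedges_b: "{v \<in> gverts B_graph. {1, v} \<in> gedges petersen} = {B_b1, B_b2}"
  unfolding petersen_neighbours
  by (auto simp: B_graph_def remove_verts_def petersen_def B_b1_def B_b2_def)

text \<open>A 2-regular graph \<open>D\<close> is written as a family of cyclic sequences \<open>(v\<^sub>1, \<dots>, v\<^sub>k)\<close>
  by giving the successor map \<open>v\<^sub>i \<mapsto> v\<^sub>i\<^sub>+\<^sub>1\<close>. Since \<open>D\<close> has as many edges as vertices, the edge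
  condition makes \<open>v \<mapsto> {v, s v}\<close> injective on the vertices, so each orbit of \<open>s\<close> runs once around a
  component cycle.\<close>

definition cyclic_successor :: "'a ugraph \<Rightarrow> ('a \<Rightarrow> 'a) \<Rightarrow> bool" where
  "cyclic_successor D s \<longleftrightarrow> bij_betw s (gverts D) (gverts D) \<and>
     gedges D = (\<lambda>v. {v, s v}) ` gverts D"

text \<open>\<open>U v\<^sub>i\<close> and \<open>W v\<^sub>i\<close> are the new vertices \<open>u\<^sub>i\<close> and \<open>w\<^sub>i\<close>, and \<open>Pole v\<^sub>i p\<close> is the
  vertex \<open>p\<close> of the copy \<open>B\<^sub>i\<close>.\<close>

datatype 'a blowup_vertex = Orig 'a | U 'a | W 'a | Pole 'a nat

definition blowup :: "'a ugraph \<Rightarrow> 'a ugraph \<Rightarrow> ('a \<Rightarrow> 'a) \<Rightarrow> 'a blowup_vertex ugraph" where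
  "blowup G D s =
    \<lparr>gverts = Orig ` gverts G \<union>
       (\<Union>v \<in> gverts D. {U v, W v} \<union> Pole v ` gverts B_graph),
     gedges = (\<lambda>e. Orig ` e) ` (gedges G - gedges D) \<union>
       (\<Union>v \<in> gverts D. (\<lambda>e. Pole v ` e) ` gedges B_graph \<union>
         {{Orig v, U v}, {Orig v, W v},
          {U v, Pole v B_b1}, {W v, Pole v B_b2},
          {Pole v B_a1, U (s v)}, {Pole v B_a2, W (s v)}})\<rparr>"

end

theory Submission
  imports Defs
begin

text \<open>Suppose that a cycle double cover contains the cycles of a 2-factor \<open>F\<close>, and label every edge with
  the remaining cycles of the cover that use it. Edges of \<open>F\<close> get one label, the others two, and
  the three label sets at a vertex are \<open>{p}\<close>, \<open>{q}\<close>, \<open>{p, q}\<close> with \<open>p \<noteq> q\<close>. The Petersen graph has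
  no such labelling. Every label occurs an even number of times on the semiedges of \<open>B\<close>, so this
  has two consequences for a copy of \<open>B\<close> in a labelled graph. If all four semiedges are in \<open>F\<close>, then
  \<open>a\<^sub>1, a\<^sub>2\<close> have the same label, and so have \<open>b\<^sub>1, b\<^sub>2\<close>. If exactly one of
  \<open>a\<^sub>1, a\<^sub>2\<close> and one of \<open>b\<^sub>1, b\<^sub>2\<close> is in \<open>F\<close>, then the labels of \<open>a\<^sub>1, a\<^sub>2\<close> are disjoint, and so
  are those of \<open>b\<^sub>1, b\<^sub>2\<close>. Parity forces a copy of the first and one of the second kind to be joined
  through some \<open>v\<^sub>i\<close> whose edge to the fourth vertex of \<open>K\<^sub>4\<close> is in \<open>F\<close>; but there equal labels on
  one side produce intersecting label sets on the other.\<close>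

section \<open>Labellings of the Petersen graph and of the 4-pole\<close>

text \<open>In \<open>join x y z\<close> the edge \<open>x\<close> is the one outside the 2-factor.\<close>

definition join :: "'l set \<Rightarrow> 'l set \<Rightarrow> 'l set \<Rightarrow> bool" where
  "join x y z \<longleftrightarrow> (\<exists>p q. p \<noteq> q \<and> x = {p, q} \<and> y = {p} \<and> z = {q})"

definition node :: "'l set \<Rightarrow> 'l set \<Rightarrow> 'l set \<Rightarrow> bool" where
  "node x y z \<longleftrightarrow> join x y z \<or> join y x z \<or> join z x y"

abbreviation single :: "'l set \<Rightarrow> bool" where
  "single \<equiv> is_singleton"

lemma join_swap: "join x y z \<longleftrightarrow> join x z y"
  unfolding join_def by (metis insert_commute)

lemma node_perms:
  assumes "node x y z"
  shows "node x y z \<and> node x z y \<and> node y x z \<and> node y z x \<and> node z x y \<and> node z y x"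
  using assms join_swap[of x y z] join_swap[of y x z] join_swap[of z x y] unfolding node_def by argo

text \<open>With \<open>single\<close> read as membership in the 2-factor, the other edges form a
  perfect matching; in this propositional form the possible matchings can be enumerated.\<close>

lemma node_single:
  assumes "node x y z"
  shows "\<not> single x \<and> single y \<and> single z \<or> single x \<and> \<not> single y \<and> single z \<or>
    single x \<and> single y \<and> \<not> single z"
  using assms unfolding node_def join_def by (auto simp: is_singleton_def doubleton_eq_iff)

lemma node_parity:
  assumes "node x y z"
  shows "(c \<in> z) = ((c \<in> x) \<noteq> (c \<in> y))"
  using assms unfolding node_def join_def by auto

lemma node_singleI:
  assumes "z = sym_diff x y" "single x" "single y" "x \<noteq> y"
  shows "node x y z"
  using assms unfolding node_def join_def is_singleton_def by auto

text \<open>\<open>eij\<close> is the label set of the edge of \<open>B\<close> between the vertices \<open>i\<close> and \<open>j\<close>.\<close>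

definition pole :: "'l set \<Rightarrow> 'l set \<Rightarrow> 'l set \<Rightarrow> 'l set \<Rightarrow> bool" where
  "pole a1 a2 b1 b2 \<longleftrightarrow> (\<exists>e49 e96 e34 e38 e85 e23 e27 e79 e68 e57.
     node a1 e34 e49 \<and> node a2 e85 e57 \<and> node b1 e23 e27 \<and> node b2 e96 e68 \<and>
     node e34 e23 e38 \<and> node e27 e79 e57 \<and> node e38 e85 e68 \<and> node e49 e96 e79)"

text \<open>The two labels on a matching edge \<open>m\<close> leave each of its ends along
  different edges of the 2-factor, so both ends show the same pair of labels.\<close>

lemma matched_pair:
  assumes "node x y m" "node x' y' m" "\<not> single m"
  shows "x \<noteq> y \<and> single x \<and> single y \<and> (x = x' \<and> y = y' \<or> x = y' \<and> y = x')"
  using assms unfolding node_def join_def by (auto simp: doubleton_eq_iff is_singleton_def)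

text \<open>Deleting a perfect matching leaves two 5-cycles. Consecutive edges on them have
  different labels, and the two ends of a matching edge see the same pair. No label occurs more than
  twice on a 5-cycle, so by oddness some label occurs exactly once on the first. On the second it
  would need an edge joining the partners of the two ends, but the Petersen graph has no
  4-cycle.\<close>

lemma petersen_matching_xy:
  assumes "node a1 a2 xy" "node b1 b2 xy"
    "node a1 e34 e49" "node a2 e85 e57" "node b1 e23 e27" "node b2 e96 e68"
    "node e34 e23 e38" "node e27 e79 e57" "node e38 e85 e68" "node e49 e96 e79"
    and xy: "\<not> single xy"
  shows False
proof -
  note s = assms(1-10)[THEN node_single]
  note n = assms(1-10)[THEN node_perms]
  have m0: "a1 \<noteq> a2" "a1 = b1 \<and> a2 = b2 \<or> a1 = b2 \<and> a2 = b1"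
    using matched_pair[of a1 a2 xy b1 b2] n xy by blast+
  \<comment> \<open>the two perfect matchings of the Petersen graph that contain \<open>xy\<close>\<close>
  have "\<not> single e34 \<and> \<not> single e27 \<and> \<not> single e85 \<and> \<not> single e96 \<or>
    \<not> single e49 \<and> \<not> single e57 \<and> \<not> single e23 \<and> \<not> single e68"
    using s xy by argo
  then show False
  proof
    assume d: "\<not> single e34 \<and> \<not> single e27 \<and> \<not> single e85 \<and> \<not> single e96"
    have m1: "a1 \<noteq> e49" "a1 = e23 \<and> e49 = e38 \<or> a1 = e38 \<and> e49 = e23"
      using matched_pair[of a1 e49 e34 e23 e38] n d by blast+
    have m2: "b1 \<noteq> e23" "b1 = e79 \<and> e23 = e57 \<or> b1 = e57 \<and> e23 = e79"
      using matched_pair[of b1 e23 e27 e79 e57] n d by blast+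
    have m3: "a2 \<noteq> e57" "a2 = e38 \<and> e57 = e68 \<or> a2 = e68 \<and> e57 = e38"
      using matched_pair[of a2 e57 e85 e38 e68] n d by blast+
    have m4: "b2 \<noteq> e68" "b2 = e49 \<and> e68 = e79 \<or> b2 = e79 \<and> e68 = e49"
      using matched_pair[of b2 e68 e96 e49 e79] n d by blast+
    show False using m0 m1 m2 m3 m4 by metis
  next
    assume d: "\<not> single e49 \<and> \<not> single e57 \<and> \<not> single e23 \<and> \<not> single e68"
    have m1: "a1 \<noteq> e34" "a1 = e96 \<and> e34 = e79 \<or> a1 = e79 \<and> e34 = e96"
      using matched_pair[of a1 e34 e49 e96 e79] n d by blast+
    have m2: "b1 \<noteq> e27" "b1 = e34 \<and> e27 = e38 \<or> b1 = e38 \<and> e27 = e34"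
      using matched_pair[of b1 e27 e23 e34 e38] n d by blast+
    have m3: "a2 \<noteq> e85" "a2 = e27 \<and> e85 = e79 \<or> a2 = e79 \<and> e85 = e27"
      using matched_pair[of a2 e85 e57 e27 e79] n d by blast+
    have m4: "b2 \<noteq> e96" "b2 = e38 \<and> e96 = e85 \<or> b2 = e85 \<and> e96 = e38"
      using matched_pair[of b2 e96 e68 e38 e85] n d by blast+
    show False using m0 m1 m2 m3 m4 by metis
  qed
qed

text \<open>\<open>pole\<close> and the nodes at \<open>x\<close> and \<open>y\<close> make up the
  whole Petersen graph. This excludes labels of the semiedges that extend over the deleted edge
  \<open>xy\<close>.\<close>

lemma no_petersen_labelling:
  assumes "pole a1 a2 b1 b2" "node a1 a2 xy" "node b1 b2 xy"
  shows False
proof -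
  obtain e49 e96 e34 e38 e85 e23 e27 e79 e68 e57 where
    n: "node a1 e34 e49" "node a2 e85 e57" "node b1 e23 e27" "node b2 e96 e68"
     "node e34 e23 e38" "node e27 e79 e57" "node e38 e85 e68" "node e49 e96 e79"
    using assms(1) unfolding pole_def by blast
  note perms = assms(2,3)[THEN node_perms] n[THEN node_perms]
  consider "\<not> single xy" | "\<not> single a1" | "\<not> single a2"
    using node_single[OF assms(2)] by blast
  \<comment> \<open>Automorphisms of the Petersen graph move the matching edge at \<open>x\<close> to \<open>xy\<close>.\<close>
  then show False
  proof cases
    case 1
    show ?thesis
      by (rule petersen_matching_xy[OF assms(2,3) n 1])
  next
    case 2
    show ?thesis
      \<comment> \<open>Vertices 4 and 0 play the parts of \<open>x\<close> = 0 and \<open>y\<close>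
        = 1, and in the third case 5 and 0 do; the arguments are the images of the fifteen
        edges.\<close>
      by (rule petersen_matching_xy[of e34 e49 a1 xy a2 e23 e38 e79 e96 b1 b2 e85 e57 e27 e68])
        (simp_all add: 2 perms)
  next
    case 3
    show ?thesis
      by (rule petersen_matching_xy[of e57 e85 a2 xy a1 e27 e79 e38 e68 b1 b2 e49 e34 e23 e96])
        (simp_all add: 3 perms)
  qed
qed

text \<open>The matching covers the eight vertices of \<open>B\<close>, and each inner matching edge
  covers two, so an even number of semiedges is in the matching.\<close>

lemma pole_single_parity:
  assumes "pole a1 a2 b1 b2"
  shows "(single a1 = single a2) = (single b1 = single b2)"
proof -
  obtain e49 e96 e34 e38 e85 e23 e27 e79 e68 e57 where
    n: "node a1 e34 e49" "node a2 e85 e57" "node b1 e23 e27" "node b2 e96 e68"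
     "node e34 e23 e38" "node e27 e79 e57" "node e38 e85 e68" "node e49 e96 e79"
    using assms(1) unfolding pole_def by blast
  show ?thesis using n[THEN node_single] by argo
qed

text \<open>Adding up \<open>node_parity\<close> over the eight vertices counts every inner edge
  twice, so each label lies on an even number of semiedges.\<close>

lemma pole_sym_diff:
  assumes "pole a1 a2 b1 b2"
  shows "sym_diff a1 a2 = sym_diff b1 b2"
proof -
  obtain e49 e96 e34 e38 e85 e23 e27 e79 e68 e57 where
    n: "node a1 e34 e49" "node a2 e85 e57" "node b1 e23 e27" "node b2 e96 e68"
     "node e34 e23 e38" "node e27 e79 e57" "node e38 e85 e68" "node e49 e96 e79"
    using assms(1) unfolding pole_def by blast
  have "((c \<in> a1) = (c \<in> a2)) = ((c \<in> b1) = (c \<in> b2))" for c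
    using n[THEN node_parity, of c] by argo
  then show ?thesis by blast
qed

text \<open>If \<open>a1\<close> and \<open>a2\<close> differed, their symmetric difference, which
  is also that of \<open>b1\<close> and \<open>b2\<close>, would serve as label set of
  \<open>xy\<close>.\<close>

lemma pole_all_single:
  assumes "pole a1 a2 b1 b2" "single a1" "single a2" "single b1" "single b2"
  shows "a1 = a2 \<and> b1 = b2"
proof -
  have "a1 = a2 \<longleftrightarrow> b1 = b2" using pole_sym_diff[OF assms(1)] by blast
  then show ?thesis
    using no_petersen_labelling[OF assms(1)] pole_sym_diff[OF assms(1)] node_singleI assms(2-) by metis
qed

section \<open>Meeting label sets and extension over the deleted edge\<close>

lemma node_not_singleD:
  assumes "node x y z" "\<not> single x"
  shows "\<exists>p q. p \<noteq> q \<and> x = {p, q}"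
proof -
  obtain p q where "p \<noteq> q" "x = {p, q} \<or> x = {p} \<or> x = {q}"
    using assms(1) unfolding node_def join_def by blast
  then show ?thesis using assms(2) is_singletonI by blast
qed

text \<open>By parity, only the symmetric difference can complete \<open>x\<close> and
  \<open>y\<close> to a node. It has one element if \<open>y\<close> meets the pair \<open>x\<close>
  and three otherwise.\<close>

lemma meeting_pair:
  assumes "p \<noteq> q" "x = {p, q}" "single y"
  shows "x \<inter> y \<noteq> {} \<longleftrightarrow> single (sym_diff x y)"
    and "single (sym_diff x y) \<Longrightarrow> node x y (sym_diff x y)"
proof -
  obtain r where r: "y = {r}" using assms(3) by (auto simp: is_singleton_def)
  consider "r = p" | "r = q" | "r \<notin> {p, q}" by blast
  then have "(x \<inter> y \<noteq> {} \<longleftrightarrow> single (sym_diff x y)) \<and>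
    (single (sym_diff x y) \<longrightarrow> node x y (sym_diff x y))"
  proof cases
    case 1
    then have "sym_diff x y = {q}" using assms r by auto
    then show ?thesis using 1 assms r by (auto simp: node_def join_def)
  next
    case 2
    then have "sym_diff x y = {p}" using assms r by auto
    then show ?thesis using 2 assms r by (auto simp: node_def join_def)
  next
    case 3
    then have "p \<in> sym_diff x y" "q \<in> sym_diff x y" using assms r by auto
    then have "\<not> single (sym_diff x y)" using assms(1) by (metis is_singletonE singletonD)
    then show ?thesis using 3 assms r by auto
  qed
  then show "x \<inter> y \<noteq> {} \<longleftrightarrow> single (sym_diff x y)"
    and "single (sym_diff x y) \<Longrightarrow> node x y (sym_diff x y)" by blast+
qed

lemma meeting_edges:
  assumes "node x f g" "node y h k" "single x \<noteq> single y"
  shows "x \<inter> y \<noteq> {} \<longleftrightarrow> single (sym_diff x y)"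
    and "single (sym_diff x y) \<Longrightarrow> node x y (sym_diff x y)"
proof -
  have comm: "sym_diff y x = sym_diff x y" "y \<inter> x = x \<inter> y" by blast+
  have "(x \<inter> y \<noteq> {} \<longleftrightarrow> single (sym_diff x y)) \<and>
    (single (sym_diff x y) \<longrightarrow> node x y (sym_diff x y))"
  proof (cases "single x")
    case True
    then obtain p q where "p \<noteq> q" "y = {p, q}" using assms node_not_singleD by blast
    from meeting_pair[OF this True] show ?thesis unfolding comm using node_perms by blast
  next
    case False
    then obtain p q where "p \<noteq> q" "x = {p, q}" using assms node_not_singleD by blast
    from meeting_pair[OF this] show ?thesis using False assms(3) by blast
  qed
  then show "x \<inter> y \<noteq> {} \<longleftrightarrow> single (sym_diff x y)"
    and "single (sym_diff x y) \<Longrightarrow> node x y (sym_diff x y)" by blast+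
qed

text \<open>The symmetric differences on both sides agree, so the labels meet on both sides or on
  neither. If they met, the common difference would label \<open>xy\<close>.\<close>

lemma pole_one_double_each:
  assumes "pole a1 a2 b1 b2" "single a1 \<noteq> single a2" "single b1 \<noteq> single b2"
  shows "a1 \<inter> a2 = {} \<and> b1 \<inter> b2 = {}"
proof -
  obtain e49 e96 e34 e38 e85 e23 e27 e79 e68 e57 where
    n: "node a1 e34 e49" "node a2 e85 e57" "node b1 e23 e27" "node b2 e96 e68"
    using assms(1) unfolding pole_def by blast
  note a = meeting_edges[OF n(1,2) assms(2)] and b = meeting_edges[OF n(3,4) assms(3)]
  note eq = pole_sym_diff[OF assms(1)]
  have "\<not> single (sym_diff a1 a2)"
    using no_petersen_labelling[OF assms(1) a(2)] b(2) unfolding eq by blast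
  then show ?thesis using a(1) b(1) unfolding eq by blast
qed

text \<open>By parity at the three nodes, \<open>a1\<close> and \<open>a2\<close> differ exactly in
  the label of \<open>zv\<close>. Being nonempty, they cannot be disjoint.\<close>

lemma equal_pair_propagates:
  assumes "node zv u w" "node u b1 a1" "node w b2 a2"
    "single zv" "single b1" "b1 = b2"
  shows "a1 \<inter> a2 \<noteq> {}" "single a1 \<noteq> single a2"
proof -
  obtain p where p: "zv = {p}" using assms(4) by (auto simp: is_singleton_def)
  have "(c \<in> a1) = (c \<in> a2) \<longleftrightarrow> c \<noteq> p" for c
    using assms(1-3)[THEN node_parity, of c] assms(6) p by blast
  moreover have "a1 \<noteq> {}" "a2 \<noteq> {}" using assms(2,3) unfolding node_def join_def by blast+
  ultimately show "a1 \<inter> a2 \<noteq> {}" by blast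
  show "single a1 \<noteq> single a2" using assms(1-3)[THEN node_single] assms(4-6) by blast
qed

lemma equal_pair_forces_meeting:
  assumes "node zv u w" "node u b1 a1" "node w b2 a2" "single zv"
  shows "single b1 \<and> single b2 \<and> b1 = b2 \<Longrightarrow> a1 \<inter> a2 \<noteq> {}"
    and "single a1 \<and> single a2 \<and> a1 = a2 \<Longrightarrow> b1 \<inter> b2 \<noteq> {}"
  using equal_pair_propagates[OF assms(1-3)] equal_pair_propagates[OF assms(1), of a1 b1 a2 b2]
    assms node_perms by blast+

text \<open>Copy i has semiedges \<open>ai\<close>, \<open>ci\<close> towards the next corner and
  \<open>bi\<close>, \<open>di\<close> towards its own; \<open>zi\<close> joins corner i to the
  fourth vertex. At corners 2 and 3 exactly one of the four adjoining semiedges is in the matching;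
  at corner 1 it is one of \<open>b1\<close>, \<open>a3\<close> and one of \<open>d1\<close>,
  \<open>c3\<close>.\<close>

lemma no_ring_labelling_matching_z1:
  assumes z: "node z1 z2 z3" "\<not> single z1"
    and v: "node z1 u1 w1" "node z2 u2 w2" "node z3 u3 w3"
    and u: "node u1 b1 a3" "node u2 b2 a1" "node u3 b3 a2"
    and w: "node w1 d1 c3" "node w2 d2 c1" "node w3 d3 c2"
    and B: "pole a1 c1 b1 d1" "pole a2 c2 b2 d2" "pole a3 c3 b3 d3"
  shows False
proof -
  note s = z(1)[THEN node_single] v[THEN node_single] u[THEN node_single] w[THEN node_single]
    B[THEN pole_single_parity]
  have z23: "single z2" "single z3" using z node_single by blast+
  note g = equal_pair_forces_meeting[OF v(2) u(2) w(2) z23(1)] equal_pair_forces_meeting[OF v(3) u(3) w(3) z23(2)]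
  note o1 = pole_one_double_each[OF B(1)] and o2 = pole_one_double_each[OF B(2)]
  note p1 = pole_all_single[OF B(1)] and p2 = pole_all_single[OF B(2)]
    and p3 = pole_all_single[OF B(3)]
  show False
  proof (cases "single b2 = single d2")
    case True
    \<comment> \<open>Copy 2 lies wholly in the 2-factor and copy 1 has one matching edge on each
      side; they clash at corner 2.\<close>
    have "single a1 \<noteq> single c1" "single b1 \<noteq> single d1"
      "single a2" "single c2" "single b2" "single d2"
      using s z(2) True by sat+
    then show False using g(1) o1 p2 by blast
  next
    case False
    have f: "single a2 \<noteq> single c2" "single a1" "single c1" "single b3" "single d3"
      using s z(2) False by sat+
    \<comment> \<open>Now copy 2 has one matching edge on each side. Copy 1 or copy 3 has all
      semiedges in the 2-factor and clashes with it at corner 2 or 3.\<close>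
    have "single b1 \<and> single d1 \<or> single a3 \<and> single c3"
      using s z(2) f by sat
    then show False using f False g(2,3) o2 p1 p3 by blast
  qed
qed

lemma no_ring_labelling:
  assumes z: "node z1 z2 z3"
    and v: "node z1 u1 w1" "node z2 u2 w2" "node z3 u3 w3"
    and u: "node u1 b1 a3" "node u2 b2 a1" "node u3 b3 a2"
    and w: "node w1 d1 c3" "node w2 d2 c1" "node w3 d3 c2"
    and B: "pole a1 c1 b1 d1" "pole a2 c2 b2 d2" "pole a3 c3 b3 d3"
  shows False
proof -
  consider "\<not> single z1" | "\<not> single z2" | "\<not> single z3"
    using node_single[OF z] by blast
  then show False
  proof cases
    case 1
    show ?thesis by (rule no_ring_labelling_matching_z1[OF z 1 v u w B])
  next
    case 2
    have "node z2 z3 z1" using node_perms[OF z] by blast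
    from no_ring_labelling_matching_z1[OF this 2 v(2,3,1) u(2,3,1) w(2,3,1) B(2,3,1)] show ?thesis .
  next
    case 3
    have "node z3 z1 z2" using node_perms[OF z] by blast
    from no_ring_labelling_matching_z1[OF this 3 v(3,1,2) u(3,1,2) w(3,1,2) B(3,1,2)] show ?thesis .
  qed
qed

section \<open>The labelling given by a cycle double cover\<close>

definition comp_verts :: "'a ugraph \<Rightarrow> 'a \<Rightarrow> 'a set" where
  "comp_verts F v = {(x, y). {x, y} \<in> gedges F}\<^sup>* `` {v}"

definition comp_at :: "'a ugraph \<Rightarrow> 'a \<Rightarrow> 'a ugraph" where
  "comp_at F v = \<lparr>gverts = comp_verts F v, gedges = {e \<in> gedges F. e \<subseteq> comp_verts F v}\<rparr>"

lemma sym_adjacency: "sym {(x, y). {x, y} \<in> gedges F}"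
  by (auto simp: sym_def insert_commute)

lemma comp_at_eq:
  assumes "{u, v} \<in> gedges F"
  shows "comp_at F u = comp_at F v"
proof -
  let ?R = "{(x, y). {x, y} \<in> gedges F}"
  have "(u, v) \<in> ?R" "(v, u) \<in> ?R" using assms by (auto simp: insert_commute)
  then have "comp_verts F u = comp_verts F v"
    unfolding comp_verts_def by (auto intro: converse_rtrancl_into_rtrancl)
  then show ?thesis by (simp add: comp_at_def)
qed

lemma comp_at_edges:
  assumes "wf_ugraph F" "e \<in> gedges F" "v \<in> e"
  shows "e \<in> gedges (comp_at F v)"
proof -
  have "card e = 2" using assms(1,2) by (simp add: wf_ugraph_def)
  then obtain w where "e = {v, w}" using assms(3) by (auto simp: card_2_iff)
  then show ?thesis
    using assms(2) by (auto simp: comp_at_def comp_verts_def)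
qed

text \<open>Components are defined by maximality, labels by reachability. A connected subgraph
  containing \<open>v\<close> stays within reach of \<open>v\<close>, which gives
  maximality.\<close>

lemma component_comp_at:
  assumes wf: "wf_ugraph F" and v: "v \<in> gverts F"
  shows "component (comp_at F v) F"
proof -
  let ?K = "comp_at F v"
  define R where "R = {(x, y). {x, y} \<in> gedges F}"
  define RK where "RK = {(x, y). {x, y} \<in> gedges ?K}"
  have verts: "gverts ?K = R\<^sup>* `` {v}"
    by (simp add: comp_at_def comp_verts_def R_def)
  have "w \<in> gverts F" if "(v, w) \<in> R\<^sup>*" for w
    using that by induction (use v wf in \<open>auto simp: R_def wf_ugraph_def\<close>)
  then have sub: "gverts ?K \<subseteq> gverts F" by (auto simp: verts)
  then have "finite (gverts ?K)" using wf finite_subset by (auto simp: wf_ugraph_def)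
  then have subg: "subgraph ?K F"
    using wf sub by (auto simp: subgraph_def wf_ugraph_def comp_at_def)
  have reach: "(v, w) \<in> RK\<^sup>*" if "(v, w) \<in> R\<^sup>*" for w
    using that
  proof induction
    case (step y w)
    have "{y, w} \<in> gedges ?K"
      using step.hyps by (auto simp: comp_at_def comp_verts_def R_def intro: rtrancl.rtrancl_into_rtrancl)
    then show ?case using step.IH by (auto simp: RK_def intro: rtrancl.rtrancl_into_rtrancl)
  qed simp
  have symK: "sym (RK\<^sup>*)"
    unfolding RK_def by (rule sym_rtrancl[OF sym_adjacency])
  have "(x, y) \<in> RK\<^sup>*" if "x \<in> gverts ?K" "y \<in> gverts ?K" for x y
    using reach that symK by (auto simp: verts dest: symD intro: rtrancl_trans)
  moreover have "v \<in> gverts ?K" by (simp add: verts)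
  ultimately have conn: "connected_graph ?K"
    unfolding connected_graph_def RK_def by blast
  have "H = ?K" if H: "subgraph H F" "connected_graph H" "subgraph ?K H" for H
  proof -
    have vH: "v \<in> gverts H" using \<open>v \<in> gverts ?K\<close> H(3) by (auto simp: subgraph_def)
    have "{(x, y). {x, y} \<in> gedges H}\<^sup>* \<subseteq> R\<^sup>*"
      using H(1) by (intro rtrancl_mono) (auto simp: R_def subgraph_def)
    then have "gverts H \<subseteq> gverts ?K"
      using H(2) vH by (auto simp: verts connected_graph_def)
    then have "gverts H = gverts ?K" using H(3) by (auto simp: subgraph_def)
    moreover have "gedges H \<subseteq> gedges ?K"
      using H(1) calculation by (auto simp: subgraph_def wf_ugraph_def comp_at_def)
    ultimately show ?thesis using H(3) by (auto simp: subgraph_def)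
  qed
  then show ?thesis using subg conn by (simp add: component_def)
qed

text \<open>The labels are the covering cycles themselves. Only one occurrence of the component is
  removed, and by \<open>comp_at_eq\<close> the chosen end of the edge is immaterial.\<close>

definition labels :: "'a ugraph multiset \<Rightarrow> 'a ugraph \<Rightarrow> 'a set \<Rightarrow> 'a ugraph set" where
  "labels M F e = set_mset ({#H \<in># M. e \<in> gedges H#} -
     (if e \<in> gedges F then {#comp_at F (SOME v. v \<in> e)#} else {#}))"

lemma labels_factor_edge:
  assumes "wf_ugraph F" "e \<in> gedges F" "v \<in> e" "{#H \<in># M. e \<in> gedges H#} = {#comp_at F v, x#}"
  shows "labels M F e = {x}"
proof -
  define u where "u = (SOME v. v \<in> e)"
  have u: "u \<in> e" unfolding u_def using assms(3) by (rule someI)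
  have "card e = 2" using assms(1,2) by (simp add: wf_ugraph_def)
  then have "u = v \<or> e = {u, v}" using u assms(3) by (auto simp: card_2_iff)
  then have "comp_at F u = comp_at F v" using comp_at_eq[of u v F] assms(2) by auto
  then show ?thesis using assms(2,4) by (simp add: labels_def u_def)
qed

lemma regular_two_incident:
  assumes "wf_ugraph H" "regular 2 H" "{e \<in> gedges H. v \<in> e} \<subseteq> {e, f, m}"
    "m \<in> gedges H" "v \<in> m" "e \<noteq> f"  "e \<noteq> m" "f \<noteq> m" "v \<in> e" "v \<in> f"
  shows "f \<in> gedges H \<longleftrightarrow> e \<notin> gedges H"
proof -
  have "v \<in> gverts H" using assms(1,4,5) by (auto simp: wf_ugraph_def)
  then have "card {e \<in> gedges H. v \<in> e} = 2" using assms(2) by (simp add: regular_def degree_def)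
  moreover have "{e \<in> gedges H. v \<in> e} = (if e \<in> gedges H then {e} else {}) \<union>
      (if f \<in> gedges H then {f} else {}) \<union> {m}"
    using assms(3-) by auto
  ultimately show ?thesis using assms(6-8) by (auto split: if_splits)
qed

text \<open>The component \<open>K\<close> at \<open>v\<close> covers \<open>e\<close> and
  \<open>f\<close> once, leaving one further cycle \<open>x\<close> on \<open>e\<close> and
  \<open>y\<close> on \<open>f\<close>. A cycle through \<open>m\<close> leaves \<open>v\<close> by
  exactly one of \<open>e\<close>, \<open>f\<close>, and \<open>K\<close> avoids \<open>m\<close>,
  so the two cycles on \<open>m\<close> must be \<open>x\<close> and \<open>y\<close>.\<close>

lemma join_labels:
  assumes F: "two_factor F G" and M: "cycle_double_cover M G"
    and comps: "\<forall>H. component H F \<longrightarrow> H \<in># M"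
    and inc: "{e \<in> gedges G. v \<in> e} = {e, f, m}" "e \<noteq> f" "e \<noteq> m" "f \<noteq> m"
    and mem: "v \<in> gverts G" "e \<in> gedges F" "f \<in> gedges F" "m \<notin> gedges F"
  shows "join (labels M F m) (labels M F e) (labels M F f)"
proof -
  define fil where "fil = (\<lambda>e. {#H \<in># M. e \<in> gedges H#})"
  have wf: "wf_ugraph F" and vF: "v \<in> gverts F" using F mem(1) by (auto simp: two_factor_def subgraph_def)
  have G: "e \<in> gedges G" "f \<in> gedges G" "m \<in> gedges G" "v \<in> e" "v \<in> f" "v \<in> m"
    using inc(1) by blast+
  have size: "size (fil e) = 2" "size (fil f) = 2" "size (fil m) = 2"
    using M G by (auto simp: cycle_double_cover_def fil_def)
  define K where "K = comp_at F v"
  have KM: "K \<in># M" unfolding K_def using comps component_comp_at[OF wf vF] by blast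
  have Ke: "e \<in> gedges K" "f \<in> gedges K"
    unfolding K_def using comp_at_edges[OF wf] mem G by blast+
  have Km: "m \<notin> gedges K" using mem(4) by (auto simp: K_def comp_at_def)
  have fil2: "\<exists>x. fil d = {#K, x#}" if "d \<in> gedges K" "size (fil d) = 2" for d
  proof -
    have "K \<in># fil d" using KM that(1) by (simp add: fil_def)
    then obtain N where N: "fil d = add_mset K N" by (meson multi_member_split)
    then have "size N = 1" using that(2) by simp
    then show ?thesis using N size_1_singleton_mset by blast
  qed
  obtain x y where x: "fil e = {#K, x#}" and y: "fil f = {#K, y#}"
    using fil2 Ke size by metis
  have two: "f \<in> gedges H \<longleftrightarrow> e \<notin> gedges H" if "H \<in># M" "m \<in> gedges H" for H
  proof -
    have "cycle_in H G" using M that(1) by (simp add: cycle_double_cover_def)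
    then have H: "wf_ugraph H" "regular 2 H" "gedges H \<subseteq> gedges G"
      by (auto simp: cycle_in_def subgraph_def)
    then have "{e \<in> gedges H. v \<in> e} \<subseteq> {e, f, m}"
      unfolding inc(1)[symmetric] by blast
    from regular_two_incident[OF H(1,2) this that(2)] show ?thesis using G inc by blast
  qed
  have comm: "{#H \<in># fil m. d \<in> gedges H#} = {#H \<in># fil d. m \<in> gedges H#}" for d
    by (simp add: fil_def filter_filter_mset conj_commute)
  \<comment> \<open>Exchanging the two filters by \<open>comm\<close> reads the cycles through
    \<open>m\<close> off the known lists for \<open>e\<close> and \<open>f\<close>; size two then
    forces both \<open>x\<close> and \<open>y\<close> to contain \<open>m\<close>.\<close>
  have "fil m = {#H \<in># fil m. e \<in> gedges H#} + {#H \<in># fil m. e \<notin> gedges H#}"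
    by (rule multiset_partition)
  also have "{#H \<in># fil m. e \<notin> gedges H#} = {#H \<in># fil m. f \<in> gedges H#}"
    by (rule filter_mset_cong) (use two in \<open>auto simp: fil_def\<close>)
  finally have m: "fil m = (if m \<in> gedges x then {#x#} else {#}) + (if m \<in> gedges y then {#y#} else {#})"
    unfolding comm x y using Km by simp
  then have mxy: "m \<in> gedges x" "m \<in> gedges y" using size(3) by (auto split: if_splits)
  have xe: "x \<in># M" "e \<in> gedges x" "f \<in> gedges y"
  proof -
    have "x \<in># fil e" "y \<in># fil f" by (simp_all add: x y)
    then show "x \<in># M" "e \<in> gedges x" "f \<in> gedges y" by (simp_all add: fil_def)
  qed
  then have "x \<noteq> y" using two mxy by blast
  moreover have "labels M F e = {x}" "labels M F f = {y}"
    using labels_factor_edge[OF wf] mem G x y by (auto simp: fil_def K_def)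
  moreover have "labels M F m = {x, y}"
    using m mxy mem(4) by (simp add: labels_def fil_def insert_commute)
  ultimately show ?thesis unfolding join_def by blast
qed

lemma node_labels:
  assumes F: "two_factor F G" and M: "cycle_double_cover M G"
    and comps: "\<forall>H. component H F \<longrightarrow> H \<in># M"
    and v: "v \<in> gverts G"
    and inc: "{e \<in> gedges G. v \<in> e} = {e, f, m}" "e \<noteq> f" "e \<noteq> m" "f \<noteq> m"
  shows "node (labels M F e) (labels M F f) (labels M F m)"
proof -
  have sub: "{e \<in> gedges F. v \<in> e} \<subseteq> {e, f, m}"
    unfolding inc(1)[symmetric] using F by (auto simp: two_factor_def subgraph_def)
  have mem: "v \<in> e" "v \<in> f" "v \<in> m" using inc(1) by blast+
  have "card {e \<in> gedges F. v \<in> e} = 2"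
    using F v by (auto simp: two_factor_def regular_def degree_def)
  moreover have "{e \<in> gedges F. v \<in> e} = (if e \<in> gedges F then {e} else {}) \<union>
      (if f \<in> gedges F then {f} else {}) \<union> (if m \<in> gedges F then {m} else {})"
    using sub mem by auto
  ultimately consider "e \<in> gedges F" "f \<in> gedges F" "m \<notin> gedges F"
    | "e \<in> gedges F" "f \<notin> gedges F" "m \<in> gedges F"
    | "e \<notin> gedges F" "f \<in> gedges F" "m \<in> gedges F"
    using inc(2-) by (auto split: if_splits)
  then show ?thesis
  proof cases
    case 1
    from join_labels[OF F M comps inc v 1] show ?thesis by (simp add: node_def)
  next
    case 2
    have "{e \<in> gedges G. v \<in> e} = {e, m, f}" using inc(1) by auto
    from join_labels[OF F M comps this inc(3,2) inc(4)[symmetric] v 2(1,3,2)]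
    show ?thesis by (simp add: node_def)
  next
    case 3
    have "{e \<in> gedges G. v \<in> e} = {f, m, e}" using inc(1) by auto
    from join_labels[OF F M comps this inc(4) inc(2)[symmetric] inc(3)[symmetric] v 3(2,3,1)]
    show ?thesis by (simp add: node_def)
  qed
qed

section \<open>The blowup of the triangle in \<open>K\<^sub>4\<close>\<close>

lemma triangle_in_K4:
  fixes V :: "'a set"
  assumes "card V = 4" "cycle_in C (complete_graph V)" "cycle_length C = 3" "cyclic_successor C s"
  obtains z v1 v2 v3 where "distinct [z, v1, v2, v3]" "V = {z, v1, v2, v3}"
    "gverts C = {v1, v2, v3}" "s v1 = v2" "s v2 = v3" "s v3 = v1"
    "gedges C = {{v1, v2}, {v2, v3}, {v3, v1}}"
proof -
  let ?S = "gverts C"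
  have wf: "wf_ugraph C" and SV: "?S \<subseteq> V" and reg: "regular 2 C"
    using assms(2) by (auto simp: cycle_in_def subgraph_def complete_graph_def)
  have bij: "bij_betw s ?S ?S" and E: "gedges C = (\<lambda>v. {v, s v}) ` ?S"
    using assms(4) by (auto simp: cyclic_successor_def)
  have sS: "s v \<in> ?S" if "v \<in> ?S" for v using bij that by (auto simp: bij_betw_def)
  have inj: "u = v" if "s u = s v" "u \<in> ?S" "v \<in> ?S" for u v
    using bij that by (auto simp: bij_betw_def inj_on_def)
  have neq: "s v \<noteq> v" if "v \<in> ?S" for v
  proof -
    have "card {v, s v} = 2" using wf E that by (auto simp: wf_ugraph_def)
    then show ?thesis by auto
  qed
  \<comment> \<open>A swap of \<open>v\<close> and \<open>s v\<close> would leave a single edge at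
    \<open>v\<close>. Excluding swaps makes the map from \<open>v\<close> to its edge injective, so
    there are as many vertices as edges.\<close>
  have two: "s (s v) \<noteq> v" if v: "v \<in> ?S" for v
  proof
    assume ss: "s (s v) = v"
    have "{e \<in> gedges C. v \<in> e} \<subseteq> {{v, s v}}"
    proof
      fix e assume "e \<in> {e \<in> gedges C. v \<in> e}"
      then obtain u where u: "u \<in> ?S" "e = {u, s u}" "v = u \<or> v = s u" using E by auto
      then have "u = v \<or> u = s v" using inj[of u "s v"] ss sS v by auto
      then show "e \<in> {{v, s v}}" using u(2) ss by (auto simp: insert_commute)
    qed
    then have "degree C v \<le> 1"
      unfolding degree_def using card_mono[of "{{v, s v}}"] by fastforce
    then show False using reg v by (auto simp: regular_def)
  qed
  have "inj_on (\<lambda>v. {v, s v}) ?S"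
    using two by (intro inj_onI) (metis doubleton_eq_iff)
  then have card3: "card ?S = 3"
    using assms(3) E by (simp add: cycle_length_def card_image)
  then obtain v1 where v1: "v1 \<in> ?S" by fastforce
  define v2 where "v2 = s v1"
  define v3 where "v3 = s v2"
  have v23: "v2 \<in> ?S" "v3 \<in> ?S" using v1 sS by (auto simp: v2_def v3_def)
  have d: "v1 \<noteq> v2" "v2 \<noteq> v3" "v3 \<noteq> v1"
    using neq[OF v1] neq[OF v23(1)] two[OF v1] by (auto simp: v2_def v3_def)
  have fin: "finite ?S" using wf by (simp add: wf_ugraph_def)
  have S: "?S = {v1, v2, v3}"
    using card_subset_eq[OF fin, of "{v1, v2, v3}"] v1 v23 d card3 by auto
  have "s v3 \<noteq> v2" "s v3 \<noteq> v3"
    using inj[of v3 v1] neq[of v3] v1 v23 d by (auto simp: v2_def)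
  then have s3: "s v3 = v1" using sS[OF v23(2)] S by auto
  have "finite V" using assms(1) card.infinite by fastforce
  then have "card (V - ?S) = 1" using card_Diff_subset[OF fin SV] assms(1) card3 by simp
  then obtain z where z: "V - ?S = {z}" by (auto simp: card_1_singleton_iff)
  then have "V = {z, v1, v2, v3}" "z \<notin> ?S" using SV S by blast+
  moreover have "gedges C = {{v1, v2}, {v2, v3}, {v3, v1}}"
    unfolding E S using s3 by (simp add: v2_def v3_def)
  ultimately show thesis
    using d S s3 by (intro that[of z v1 v2 v3]) (auto simp: v2_def[symmetric] v3_def[symmetric])
qed

lemma K4_minus_triangle:
  assumes "distinct [z, v1, v2, v3]"
  shows "gedges (complete_graph {z, v1, v2, v3}) - {{v1, v2}, {v2, v3}, {v3, v1}} =
    {{z, v1}, {z, v2}, {z, v3}}"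
proof -
  have "gedges (complete_graph {z, v1, v2, v3}) =
    {{z, v1}, {z, v2}, {z, v3}, {v1, v2}, {v2, v3}, {v3, v1}}" (is "?L = ?R")
  proof
    show "?R \<subseteq> ?L" using assms by (auto simp: complete_graph_def card_2_iff)
    show "?L \<subseteq> ?R"
    proof
      fix e assume "e \<in> ?L"
      then obtain x y where e: "e = {x, y}" "x \<noteq> y" "x \<in> {z, v1, v2, v3}" "y \<in> {z, v1, v2, v3}"
        by (auto simp: complete_graph_def card_2_iff)
      then show "e \<in> ?R" by (elim insertE emptyE) (simp_all add: insert_commute)
    qed
  qed
  then show ?thesis using assms by (simp add: insert_Diff_if doubleton_eq_iff)
qed

section \<open>Edges incident to each vertex of the blowup\<close>

lemma B_verts: "gverts B_graph = {2, 3, 4, 5, 6, 7, 8, 9}"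
  by (auto simp: B_graph_def remove_verts_def petersen_def)

text \<open>As a rewrite rule, this form does not duplicate the remaining comprehension.\<close>

lemma Collect_insert: "{e \<in> insert a A. P e} = (if P a then insert a else id) {e \<in> A. P e}"
  by auto

lemma B_edges: "gedges B_graph =
  {{4,9},{9,6},{3,4},{3,8},{8,5},{2,3},{2,7},{7,9},{6,8},{5,7}}"
  unfolding B_graph_def remove_verts_def petersen_edges ugraph.simps Collect_insert by simp

definition ring_edges :: "('a \<Rightarrow> 'a) \<Rightarrow> 'a \<Rightarrow> 'a blowup_vertex set set" where
  "ring_edges s v =
    {{Orig v, U v}, {Orig v, W v}, {U v, Pole v 2}, {W v, Pole v 6},
     {Pole v 4, U (s v)}, {Pole v 5, W (s v)},
     {Pole v 4, Pole v 9}, {Pole v 9, Pole v 6}, {Pole v 3, Pole v 4}, {Pole v 3, Pole v 8},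
     {Pole v 8, Pole v 5}, {Pole v 2, Pole v 3}, {Pole v 2, Pole v 7}, {Pole v 7, Pole v 9},
     {Pole v 6, Pole v 8}, {Pole v 5, Pole v 7}}"

lemma blowup_edges:
  "gedges (blowup G D s) =
    (\<lambda>e. Orig ` e) ` (gedges G - gedges D) \<union> (\<Union>v \<in> gverts D. ring_edges s v)"
proof -
  have "(\<lambda>e. Pole v ` e) ` gedges B_graph \<union>
      {{Orig v, U v}, {Orig v, W v}, {U v, Pole v B_b1}, {W v, Pole v B_b2},
       {Pole v B_a1, U (s v)}, {Pole v B_a2, W (s v)}} = ring_edges s v" for v
    by (simp add: ring_edges_def B_edges B_b1_def B_b2_def B_a1_def B_a2_def)
  then show ?thesis by (simp add: blowup_def)
qed

lemma ring_edges_cases: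
  assumes "e \<in> ring_edges s v"
  shows "e \<subseteq> {Orig v, U v, W v, U (s v), W (s v)} \<union> range (Pole v)"
  using assms unfolding ring_edges_def by (elim insertE emptyE) simp_all

lemma Pole_mem_ring_edges: "e \<in> ring_edges s u \<Longrightarrow> Pole v i \<in> e \<Longrightarrow> u = v"
  and Orig_mem_ring_edges: "e \<in> ring_edges s u \<Longrightarrow> Orig v \<in> e \<Longrightarrow> u = v"
  and U_mem_ring_edges: "e \<in> ring_edges s u \<Longrightarrow> U v \<in> e \<Longrightarrow> u = v \<or> s u = v"
  and W_mem_ring_edges: "e \<in> ring_edges s u \<Longrightarrow> W v \<in> e \<Longrightarrow> u = v \<or> s u = v"
  using ring_edges_cases by fastforce+

lemma blowup_incident_Pole:
  assumes "v \<in> gverts D"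
  shows "{e \<in> gedges (blowup G D s). Pole v i \<in> e} = {e \<in> ring_edges s v. Pole v i \<in> e}"
  unfolding blowup_edges using assms Pole_mem_ring_edges by fastforce

lemma ring_edges_Pole:
    "{e \<in> ring_edges s v. Pole v 2 \<in> e} = {{U v, Pole v 2}, {Pole v 2, Pole v 3}, {Pole v 2, Pole v 7}}"
    "{e \<in> ring_edges s v. Pole v 3 \<in> e} = {{Pole v 3, Pole v 4}, {Pole v 3, Pole v 8}, {Pole v 2, Pole v 3}}"
    "{e \<in> ring_edges s v. Pole v 4 \<in> e} = {{Pole v 4, U (s v)}, {Pole v 4, Pole v 9}, {Pole v 3, Pole v 4}}"
    "{e \<in> ring_edges s v. Pole v 5 \<in> e} = {{Pole v 5, W (s v)}, {Pole v 8, Pole v 5}, {Pole v 5, Pole v 7}}"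
    "{e \<in> ring_edges s v. Pole v 6 \<in> e} = {{W v, Pole v 6}, {Pole v 9, Pole v 6}, {Pole v 6, Pole v 8}}"
    "{e \<in> ring_edges s v. Pole v 7 \<in> e} = {{Pole v 2, Pole v 7}, {Pole v 7, Pole v 9}, {Pole v 5, Pole v 7}}"
    "{e \<in> ring_edges s v. Pole v 8 \<in> e} = {{Pole v 3, Pole v 8}, {Pole v 8, Pole v 5}, {Pole v 6, Pole v 8}}"
    "{e \<in> ring_edges s v. Pole v 9 \<in> e} = {{Pole v 4, Pole v 9}, {Pole v 9, Pole v 6}, {Pole v 7, Pole v 9}}"
  unfolding ring_edges_def Collect_insert by simp_all

lemma ring_edges_UW:
  assumes "s v \<noteq> v"
  shows "{e \<in> ring_edges s v. U v \<in> e} = {{Orig v, U v}, {U v, Pole v 2}}"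
    "{e \<in> ring_edges s v. W v \<in> e} = {{Orig v, W v}, {W v, Pole v 6}}"
    "{e \<in> ring_edges s v. U (s v) \<in> e} = {{Pole v 4, U (s v)}}"
    "{e \<in> ring_edges s v. W (s v) \<in> e} = {{Pole v 5, W (s v)}}"
  using assms unfolding ring_edges_def Collect_insert by simp_all

text \<open>Two of the edges come from the ring edges of \<open>v\<close>, the third from those of
  the predecessor \<open>t\<close>, which is unique because \<open>s\<close> is injective.\<close>

lemma blowup_incident_UW:
  fixes G D :: "'a ugraph"
  assumes v: "v \<in> gverts D" "t \<in> gverts D" "s t = v" "inj_on s (gverts D)" "s v \<noteq> v"
  shows "{e \<in> gedges (blowup G D s). U v \<in> e} = {{Orig v, U v}, {U v, Pole v 2}, {Pole t 4, U v}}"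
    "{e \<in> gedges (blowup G D s). W v \<in> e} = {{Orig v, W v}, {W v, Pole v 6}, {Pole t 5, W v}}"
proof -
  have t: "u = t" if "u \<in> gverts D" "s u = v" for u
    using v that by (auto simp: inj_on_def)
  have "t \<noteq> v" using v(3,5) by blast
  then have neq: "s t \<noteq> t" using v(3) by simp
  have "{e \<in> gedges (blowup G D s). U v \<in> e} =
      {e \<in> ring_edges s v. U v \<in> e} \<union> {e \<in> ring_edges s t. U v \<in> e}"
    unfolding blowup_edges using v(1,2) t U_mem_ring_edges by fastforce
  then show "{e \<in> gedges (blowup G D s). U v \<in> e} = {{Orig v, U v}, {U v, Pole v 2}, {Pole t 4, U v}}"
    using ring_edges_UW[of s v, OF v(5)] ring_edges_UW[of s t, OF neq] v(3) by simp
  have "{e \<in> gedges (blowup G D s). W v \<in> e} =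
      {e \<in> ring_edges s v. W v \<in> e} \<union> {e \<in> ring_edges s t. W v \<in> e}"
    unfolding blowup_edges using v(1,2) t W_mem_ring_edges by fastforce
  then show "{e \<in> gedges (blowup G D s). W v \<in> e} = {{Orig v, W v}, {W v, Pole v 6}, {Pole t 5, W v}}"
    using ring_edges_UW[of s v, OF v(5)] ring_edges_UW[of s t, OF neq] v(3) by simp
qed

lemma blowup_incident_Orig:
  assumes "v \<in> gverts D"
  shows "{e \<in> gedges (blowup G D s). Orig v \<in> e} =
    (\<lambda>e. Orig ` e) ` {e \<in> gedges G - gedges D. v \<in> e} \<union> {{Orig v, U v}, {Orig v, W v}}"
proof -
  have "{e \<in> ring_edges s v. Orig v \<in> e} = {{Orig v, U v}, {Orig v, W v}}"
    unfolding ring_edges_def Collect_insert by simp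
  moreover have "{e \<in> gedges (blowup G D s). Orig v \<in> e} =
      (\<lambda>e. Orig ` e) ` {e \<in> gedges G - gedges D. v \<in> e} \<union> {e \<in> ring_edges s v. Orig v \<in> e}"
    unfolding blowup_edges using assms Orig_mem_ring_edges by fastforce
  ultimately show ?thesis by simp
qed

lemma blowup_incident_Orig_outside:
  assumes "v \<notin> gverts D"
  shows "{e \<in> gedges (blowup G D s). Orig v \<in> e} =
    (\<lambda>e. Orig ` e) ` {e \<in> gedges G - gedges D. v \<in> e}"
  unfolding blowup_edges using assms Orig_mem_ring_edges by fastforce

lemma blowup_verts:
  "v \<in> gverts G \<Longrightarrow> Orig v \<in> gverts (blowup G D s)"
  "v \<in> gverts D \<Longrightarrow> U v \<in> gverts (blowup G D s)"
  "v \<in> gverts D \<Longrightarrow> W v \<in> gverts (blowup G D s)"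
  "v \<in> gverts D \<Longrightarrow> i \<in> gverts B_graph \<Longrightarrow> Pole v i \<in> gverts (blowup G D s)"
  by (auto simp: blowup_def)

lemma pole_labels:
  fixes G D :: "'a ugraph"
  assumes v: "v \<in> gverts D"
    and node: "\<And>x e f m. x \<in> gverts (blowup G D s) \<Longrightarrow>
      {e \<in> gedges (blowup G D s). x \<in> e} = {e, f, m} \<Longrightarrow> e \<noteq> f \<Longrightarrow> e \<noteq> m \<Longrightarrow> f \<noteq> m \<Longrightarrow>
      node (L e) (L f) (L m)"
  shows "pole (L {Pole v 4, U (s v)}) (L {Pole v 5, W (s v)}) (L {U v, Pole v 2}) (L {W v, Pole v 6})"
proof -
  have "node (L e) (L f) (L m)"
    if "{e \<in> ring_edges s v. Pole v i \<in> e} = {e, f, m}" "i \<in> gverts B_graph"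
      "e \<noteq> f" "e \<noteq> m" "f \<noteq> m" for i e f m
    by (rule node[OF blowup_verts(4)[OF v that(2)]])
      (use that in \<open>simp_all add: blowup_incident_Pole[OF v]\<close>)
  note n = ring_edges_Pole[of s v, THEN this, unfolded B_verts doubleton_eq_iff, simplified]
  show ?thesis
    \<comment> \<open>Only at vertices 3 and 4 of the copy are the edges listed in another order
      than in \<open>pole\<close>.\<close>
    unfolding pole_def using n(1,4-) n(2,3)[THEN node_perms] by blast
qed

theorem mainTheorem5:
  fixes V :: "'a set" and C :: "'a ugraph" and s :: "'a \<Rightarrow> 'a"
  assumes "card V = 4"
    and "cycle_in C (complete_graph V)"
    and "cycle_length C = 3"
    and "cyclic_successor C s"
  shows "\<not> (\<exists>F M. two_factor F (blowup (complete_graph V) C s) \<and>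
                   cycle_double_cover M (blowup (complete_graph V) C s) \<and>
                   (\<forall>H. component H F \<longrightarrow> H \<in># M))"
proof
  let ?G = "blowup (complete_graph V) C s"
  assume "\<exists>F M. two_factor F ?G \<and> cycle_double_cover M ?G \<and> (\<forall>H. component H F \<longrightarrow> H \<in># M)"
  then obtain F M where FM: "two_factor F ?G" "cycle_double_cover M ?G"
    "\<forall>H. component H F \<longrightarrow> H \<in># M" by blast
  define L where "L = labels M F"
  note node = node_labels[OF FM, folded L_def]
  obtain z v1 v2 v3 where d: "distinct [z, v1, v2, v3]" and V: "V = {z, v1, v2, v3}"
    and C: "gverts C = {v1, v2, v3}" and s: "s v1 = v2" "s v2 = v3" "s v3 = v1"
    and E: "gedges C = {{v1, v2}, {v2, v3}, {v3, v1}}"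
    using triangle_in_K4[OF assms] .
  have OrigG: "Orig x \<in> gverts ?G" if "x \<in> V" for x
    by (rule blowup_verts(1)) (simp add: complete_graph_def that)
  have inj: "inj_on s (gverts C)" using d by (auto simp: C s inj_on_def)
  have E': "gedges (complete_graph V) - gedges C = {{z, v1}, {z, v2}, {z, v3}}"
    unfolding V E by (rule K4_minus_triangle[OF d])
  have z: "node (L {Orig z, Orig v1}) (L {Orig z, Orig v2}) (L {Orig z, Orig v3})"
  proof (rule node)
    show "Orig z \<in> gverts ?G" by (rule OrigG) (simp add: V)
    show "{e \<in> gedges ?G. Orig z \<in> e} = {{Orig z, Orig v1}, {Orig z, Orig v2}, {Orig z, Orig v3}}"
      using d by (subst blowup_incident_Orig_outside) (simp_all only: C E' Collect_insert, auto)
  qed (use d in \<open>simp_all add: doubleton_eq_iff\<close>)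
  have v: "node (L {Orig z, Orig v}) (L {Orig v, U v}) (L {Orig v, W v})" if "v \<in> gverts C" for v
  proof (rule node)
    show "Orig v \<in> gverts ?G" by (rule OrigG) (use that in \<open>auto simp: C V\<close>)
    show "{e \<in> gedges ?G. Orig v \<in> e} = {{Orig z, Orig v}, {Orig v, U v}, {Orig v, W v}}"
      unfolding blowup_incident_Orig[OF that] E' Collect_insert using that d
      by (auto simp: C insert_commute)
  qed (simp_all add: doubleton_eq_iff)
  have u: "node (L {Orig v, U v}) (L {U v, Pole v 2}) (L {Pole t 4, U v})"
    and w: "node (L {Orig v, W v}) (L {W v, Pole v 6}) (L {Pole t 5, W v})"
    if "v \<in> gverts C" "t \<in> gverts C" "s t = v" for v t
  proof -
    have "s v \<noteq> v" using that(1) d by (auto simp: C s)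
    note inc = blowup_incident_UW[OF that inj this]
    show "node (L {Orig v, U v}) (L {U v, Pole v 2}) (L {Pole t 4, U v})"
      by (rule node[OF _ inc(1)]) (use that in \<open>simp_all add: blowup_verts doubleton_eq_iff\<close>)
    show "node (L {Orig v, W v}) (L {W v, Pole v 6}) (L {Pole t 5, W v})"
      by (rule node[OF _ inc(2)]) (use that in \<open>simp_all add: blowup_verts doubleton_eq_iff\<close>)
  qed
  have B: "pole (L {Pole v 4, U (s v)}) (L {Pole v 5, W (s v)}) (L {U v, Pole v 2}) (L {W v, Pole v 6})"
    if "v \<in> gverts C" for v
    by (rule pole_labels[OF that node])
  have m: "v1 \<in> gverts C" "v2 \<in> gverts C" "v3 \<in> gverts C" using C by auto
  \<comment> \<open>The \<open>a\<close> semiedges of a copy end at the next corner, so corner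
    \<open>v1\<close> is paired with the copy at \<open>v3\<close>, and cyclically.\<close>
  show False
    by (rule no_ring_labelling[OF z v[OF m(1)] v[OF m(2)] v[OF m(3)]
          u[OF m(1,3) s(3)] u[OF m(2,1) s(1)] u[OF m(3,2) s(2)]
          w[OF m(1,3) s(3)] w[OF m(2,1) s(1)] w[OF m(3,2) s(2)]
          B[OF m(1), unfolded s] B[OF m(2), unfolded s] B[OF m(3), unfolded s]])
qed

end
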